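(* Let $I\subseteq\mathbb{R}$ be a nonempty open interval and let $f,g:I\to\mathbb{R}$ be strictly monotone continuous functions. Let $n\ge 2$ and let $p=(p_1,\dots,p_n):I\to\mathbb{R}_+^n$ and $q=(q_1,\dots,q_n):I\to\mathbb{R}_+^n$. Assume that $p$ is continuous on $I$ and that there exist indices $i,j\in\{1,\dots,n\}$, $i\neq j$, and a nonempty open subinterval $I_0$ of $I$ such that (a) $p_i(x)\neq p_j(x)$ for all $x\in I_0$; (b) $p_i\circ f^{-1}$ and $p_j\circ f^{-1}$ are continuously differentiable on the interval $f(I_0)$; (c) $g\circ f^{-1}$ is continuously differentiable on the interval $f(I_0)$ with a nonvanishing first derivative. Then the following assertions are equivalent to each other: (i) The means $A_{f,p}$ and $A_{g,q}$ are globally equal on $I^n$. (ii) The means $A_{f,p}$ and $A_{g,q}$ are locally equal on $I^n$. (iii) There exist $a,b,c,d\in\mathbb{R}$ with $ad\neq bc$ such that $$cf+d>0,\qquad g=\frac{af+b}{cf+d},\qquad\text{and}\qquad q=(cf+d)p$$ hold on $I$.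
   Context: $\mathbb{R}_+$ denotes the set of positive real numbers. For a strictly monotone function $f:I\to\mathbb{R}$, $f^{(-1)}:\mathrm{conv}(f(I))\to I$ denotes its generalized left inverse: the uniquely determined monotone function with $f^{(-1)}(f(x))=x$ for all $x\in I$, where $\mathrm{conv}(S)$ is the smallest interval containing $S$ (if $f$ is continuous, this is the ordinary inverse $f^{-1}:f(I)\to I$). For $p=(p_1,\dots,p_n):I\to\mathbb{R}_+^n$, the $n$-variable generalized Bajraktarević mean $A_{f,p}:I^n\to I$ is defined by $$A_{f,p}(x):=f^{(-1)}\bigg(\frac{p_1(x_1)f(x_1)+\dots+p_n(x_n)f(x_n)}{p_1(x_1)+\dots+p_n(x_n)}\bigg)\qquad (x=(x_1,\dots,x_n)\in I^n).$$ Two functions $F,G:I^n\to\mathbb{R}$ are locally equal on $I^n$ if there is an open set $U\subseteq I^n$ containing the diagonal $\{(x,\dots,x)\mid x\in I\}$ such that $F(x)=G(x)$ for all $x\in U$; they are globally equal on $I^n$ if $F(x)=G(x)$ for all $x\in I^n$. *)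

theory Defs
  imports "HOL-Analysis.Analysis"
begin

definition strictly_monotone_on :: "real set \<Rightarrow> (real \<Rightarrow> real) \<Rightarrow> bool" where
  "strictly_monotone_on I f \<longleftrightarrow> strict_mono_on I f \<or> strict_antimono_on I f"

text \<open>
  The interval hull of the image is its smallest enclosing interval \<open>conv (f(I))\<close>. The
  extensional function space makes the description unique: the value outside that interval is
  fixed to be \<open>undefined\<close>.
\<close>

definition gen_left_inverse :: "real set \<Rightarrow> (real \<Rightarrow> real) \<Rightarrow> real \<Rightarrow> real" where
  "gen_left_inverse I f =
     (THE h. h \<in> (is_interval hull (f ` I)) \<rightarrow>\<^sub>E I \<and>
             (mono_on (is_interval hull (f ` I)) h \<or> antimono_on (is_interval hull (f ` I)) h) \<and>
             (\<forall>x\<in>I. h (f x) = x))"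

text \<open>The definite description is meaningful: for continuous \<open>f\<close> it is the ordinary inverse.\<close>

lemma gen_left_inverse_eq_inv_into:
  assumes "is_interval I" "continuous_on I f" "strictly_monotone_on I f"
  shows "gen_left_inverse I f = restrict (inv_into I f) (f ` I)"
proof -
  have inj: "inj_on f I"
    using assms(3) unfolding strictly_monotone_on_def
    by (auto intro!: inj_onI simp: monotone_on_def) (metis linorder_neqE less_irrefl)+
  have hull: "is_interval hull (f ` I) = f ` I"
    using assms(1,2) by (intro hull_same)
      (simp add: is_interval_connected_1 connected_continuous_image)
  have mono: "mono_on (f ` I) (restrict (inv_into I f) (f ` I)) \<or>
      antimono_on (f ` I) (restrict (inv_into I f) (f ` I))"
    using assms(3) unfolding strictly_monotone_on_def
  proof
    assume f: "strict_mono_on I f"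
    have "mono_on (f ` I) (restrict (inv_into I f) (f ` I))"
      using f inj by (auto simp: monotone_on_def inv_into_f_f not_le[symmetric])
    then show ?thesis ..
  next
    assume f: "strict_antimono_on I f"
    have "antimono_on (f ` I) (restrict (inv_into I f) (f ` I))"
      using f inj by (auto simp: monotone_on_def inv_into_f_f not_le[symmetric])
    then show ?thesis ..
  qed
  show ?thesis
    unfolding gen_left_inverse_def hull
  proof (rule the_equality)
    show "restrict (inv_into I f) (f ` I) \<in> f ` I \<rightarrow>\<^sub>E I \<and>
        (mono_on (f ` I) (restrict (inv_into I f) (f ` I)) \<or>
         antimono_on (f ` I) (restrict (inv_into I f) (f ` I))) \<and>
        (\<forall>x\<in>I. restrict (inv_into I f) (f ` I) (f x) = x)"
      using mono inj by (auto simp: inv_into_f_f)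
  next
    fix h assume h: "h \<in> f ` I \<rightarrow>\<^sub>E I \<and> (mono_on (f ` I) h \<or> antimono_on (f ` I) h) \<and>
        (\<forall>x\<in>I. h (f x) = x)"
    show "h = restrict (inv_into I f) (f ` I)"
    proof
      fix y show "h y = restrict (inv_into I f) (f ` I) y"
        using h inj by (cases "y \<in> f ` I") (auto simp: inv_into_f_f PiE_def extensional_def)
    qed
  qed
qed

definition cube :: "real set \<Rightarrow> (real ^ 'n) set" where
  "cube I = {x. \<forall>i. x $ i \<in> I}"

definition bajraktarevic_mean ::
    "real set \<Rightarrow> (real \<Rightarrow> real) \<Rightarrow> (real \<Rightarrow> real ^ 'n) \<Rightarrow> real ^ 'n \<Rightarrow> real" where
  "bajraktarevic_mean I f p x =
     gen_left_inverse I f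
       ((\<Sum>i\<in>UNIV. p (x $ i) $ i * f (x $ i)) / (\<Sum>i\<in>UNIV. p (x $ i) $ i))"

definition globally_equal :: "real set \<Rightarrow> (real ^ 'n \<Rightarrow> real) \<Rightarrow> (real ^ 'n \<Rightarrow> real) \<Rightarrow> bool" where
  "globally_equal I F G \<longleftrightarrow> (\<forall>x\<in>cube I. F x = G x)"

definition locally_equal :: "real set \<Rightarrow> (real ^ 'n \<Rightarrow> real) \<Rightarrow> (real ^ 'n \<Rightarrow> real) \<Rightarrow> bool" where
  "locally_equal I F G \<longleftrightarrow>
     (\<exists>U. open U \<and> U \<subseteq> cube I \<and> (\<forall>t\<in>I. (\<chi> i. t) \<in> U) \<and> (\<forall>x\<in>U. F x = G x))"

end

theory Submission
  imports Defs
begin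

text \<open>
  Conjugating by \<open>f\<close> reduces to the case where \<open>f\<close> is the identity of the open interval
  \<open>J = f(I)\<close>, with \<open>h = g \<circ> f\<^sup>-\<^sup>1\<close> and weights \<open>P\<close>, \<open>Q\<close>. Let two coordinates \<open>x, y\<close> vary and put
  all others at the mean \<open>m\<close>. Local equality then says that, near the diagonal,
  \<open>P k x (x - m) + P l y (y - m) = 0\<close> implies
  \<open>Q k x (h x - h m) + Q l y (h y - h m) = 0\<close>.

  If \<open>h\<close> is differentiable at \<open>m\<close> with nonzero derivative, letting \<open>x, y \<rightarrow> m\<close> shows that
  \<open>Q k m / P k m\<close> does not depend on \<open>k\<close>; call it \<open>\<lambda> m\<close>. Hence
  \<open>\<lambda> x (h x - h m) / (x - m)\<close> takes the same value at \<open>x\<close> and at its partner \<open>y\<close>. If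
  \<open>P k < P l\<close> near \<open>m\<close>, passing to the partner is a contraction towards \<open>m\<close>, so this quotient is
  constant in \<open>x\<close>. Comparing two values of \<open>m\<close> shows that \<open>\<lambda>\<close> and \<open>\<lambda> h\<close> are affine on a
  small interval. This representation propagates over all of \<open>J\<close>, where no differentiability is
  known: at a point just outside the region already treated, the exchange relation for two
  different \<open>m\<close> is a nonsingular linear system for \<open>Q k\<close> and \<open>Q k h\<close>.
\<close>

section \<open>Continuation along an interval and an intermediate value argument\<close>

text \<open>The infimum \<open>b\<close> of the failures in \<open>[0, T]\<close> is positive by
  \<open>init\<close>. By \<open>closed\<close> it is no failure itself, and \<open>step\<close>
  keeps failures away from it on the right, so it cannot be their infimum.\<close>

lemma real_continuation:
  fixes R :: "real \<Rightarrow> bool"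
  assumes init: "0 < \<epsilon>" "\<And>t. 0 \<le> t \<Longrightarrow> t < \<epsilon> \<Longrightarrow> R t"
    and closed: "\<And>t. 0 < t \<Longrightarrow> t \<le> T \<Longrightarrow> (\<And>u. 0 \<le> u \<Longrightarrow> u < t \<Longrightarrow> R u) \<Longrightarrow> R t"
    and step: "\<And>t. 0 < t \<Longrightarrow> t < T \<Longrightarrow> (\<And>u. 0 \<le> u \<Longrightarrow> u \<le> t \<Longrightarrow> R u) \<Longrightarrow>
      \<exists>\<eta>>0. \<forall>u. t < u \<and> u < t + \<eta> \<longrightarrow> R u"
    and T: "0 \<le> T"
  shows "R T"
proof (rule ccontr)
  assume neg: "\<not> R T"
  define B where "B = {t. 0 \<le> t \<and> t \<le> T \<and> \<not> R t}"
  have TB: "T \<in> B" using neg T by (simp add: B_def)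
  have B_ge: "\<epsilon> \<le> t" if "t \<in> B" for t
    using that init(2)[of t] by (force simp: B_def not_le)
  have bdd: "bdd_below B" by (rule bdd_belowI[of _ 0]) (simp add: B_def)
  define b where "b = Inf B"
  have b0: "b > 0"
    using cInf_greatest[of B \<epsilon>] TB B_ge init(1) by (force simp: b_def)
  have bT: "b \<le> T" unfolding b_def by (rule cInf_lower[OF TB bdd])
  have below: "R u" if "0 \<le> u" "u < b" for u
  proof (rule ccontr)
    assume "\<not> R u"
    then have "u \<in> B" using that bT by (simp add: B_def)
    then show False using cInf_lower[OF _ bdd, of u] that by (simp add: b_def)
  qed
  have Rb: "R b" by (rule closed[OF b0 bT below])
  then have "b < T" using neg bT by (cases "b = T") auto
  moreover have "R u" if "0 \<le> u" "u \<le> b" for u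
    using below[of u] Rb that by (cases "u = b") auto
  ultimately obtain \<eta> where \<eta>: "\<eta> > 0" "\<And>u. b < u \<Longrightarrow> u < b + \<eta> \<Longrightarrow> R u"
    using step[OF b0] by blast
  have "b + \<eta> \<le> t" if "t \<in> B" for t
  proof (rule ccontr)
    assume "\<not> b + \<eta> \<le> t"
    moreover have "b \<le> t" unfolding b_def by (rule cInf_lower[OF that bdd])
    moreover have "t \<noteq> b" using that Rb by (auto simp: B_def)
    ultimately show False using \<eta>(2)[of t] that by (simp add: B_def)
  qed
  then have "b + \<eta> \<le> b" using cInf_greatest[of B "b + \<eta>"] TB unfolding b_def by blast
  then show False using \<eta>(1) by simp
qed

text \<open>For \<open>y = m - \<tau> * (x - m)\<close> the balance
  \<open>w * (x - m) + \<phi> y * (y - m) = 0\<close> follows from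
  \<open>\<tau> * \<phi> y = w\<close>. The product is 0 at \<open>\<tau> = 0\<close> and at least
  \<open>w\<close> at \<open>\<tau> = C\<close>. The bound \<open>\<tau> \<le> C\<close> later
  controls the distance from \<open>y\<close> to \<open>m\<close>.\<close>

lemma balanced_partner:
  fixes \<phi> :: "real \<Rightarrow> real"
  assumes "0 < C" "0 < w" "continuous_on (closed_segment m (m - C * (x - m))) \<phi>"
    and "w \<le> C * \<phi> (m - C * (x - m))"
  obtains \<tau> where "0 < \<tau>" "\<tau> \<le> C" "\<tau> * \<phi> (m - \<tau> * (x - m)) = w"
proof -
  let ?G = "\<lambda>\<tau>. \<tau> * \<phi> (m - \<tau> * (x - m))"
  have sub: "(\<lambda>\<tau>. m - \<tau> * (x - m)) ` {0..C} \<subseteq> closed_segment m (m - C * (x - m))"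
  proof clarify
    fix \<tau> assume \<tau>: "\<tau> \<in> {0..C}"
    then show "m - \<tau> * (x - m) \<in> closed_segment m (m - C * (x - m))"
      unfolding closed_segment_def using assms(1)
      by (intro CollectI exI[of _ "\<tau> / C"]) (auto simp: field_simps)
  qed
  have "continuous_on {0..C} ?G"
    by (intro continuous_intros continuous_on_compose2[OF assms(3) _ sub])
  moreover have "?G 0 \<le> w" "w \<le> ?G C" using assms by auto
  ultimately obtain \<tau> where "0 \<le> \<tau>" "\<tau> \<le> C" "?G \<tau> = w"
    using IVT'[of ?G 0 w C] assms(1) by auto
  with assms(2) show thesis by (intro that[of \<tau>]) (auto simp: less_le)
qed

section \<open>The exchange relation after conjugation by \<open>f\<close>\<close>

text \<open>In \<open>exchange\<close> no nearness is asked of \<open>m\<close>: for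
  \<open>x\<close>, \<open>y\<close> in \<open>J\<close> the weights are positive, so the balance
  forces \<open>m\<close> between \<open>x\<close> and \<open>y\<close>. One \<open>\<delta>\<close>
  serves all pairs of indices.\<close>

locale pair_exchange =
  fixes J :: "real set" and h :: "real \<Rightarrow> real" and P Q :: "'k::finite \<Rightarrow> real \<Rightarrow> real"
  assumes open_J: "open J" and interval_J: "is_interval J"
    and cont_h: "continuous_on J h" and inj_h: "inj_on h J"
    and cont_P: "continuous_on J (P k)"
    and P_pos: "x \<in> J \<Longrightarrow> P k x > 0" and Q_pos: "x \<in> J \<Longrightarrow> Q k x > 0"
    and two_indices: "\<exists>l::'k. l \<noteq> k"
    and exchange: "e \<in> J \<Longrightarrow> \<exists>\<delta>>0. \<forall>x y m k l. k \<noteq> l \<longrightarrow> \<bar>x - e\<bar> < \<delta> \<longrightarrow> \<bar>y - e\<bar> < \<delta> \<longrightarrow>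
      P k x * (x - m) + P l y * (y - m) = 0 \<longrightarrow>
      Q k x * (h x - h m) + Q l y * (h y - h m) = 0"
begin

lemma isCont_h: "x \<in> J \<Longrightarrow> isCont h x"
  using cont_h open_J by (simp add: continuous_on_eq_continuous_at)

lemma isCont_P: "x \<in> J \<Longrightarrow> isCont (P k) x"
  using cont_P open_J by (simp add: continuous_on_eq_continuous_at)

lemma ball_in_J:
  assumes "e \<in> J" obtains \<delta> where "\<delta> > 0" "\<And>x. \<bar>x - e\<bar> < \<delta> \<Longrightarrow> x \<in> J"
  using open_J assms unfolding open_dist dist_real_def by blast

text \<open>Fixing the second point solves the exchange relation for \<open>Q k\<close> in terms of the
  continuous functions \<open>P k\<close> and \<open>h\<close>.\<close>

lemma isCont_Q:
  assumes e: "e \<in> J" shows "isCont (Q k) e"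
proof -
  obtain l where l: "k \<noteq> l" using two_indices[of k] by metis
  obtain \<delta>1 where \<delta>1: "\<delta>1 > 0" "\<And>x y m. \<lbrakk>\<bar>x - e\<bar> < \<delta>1; \<bar>y - e\<bar> < \<delta>1;
      P k x * (x - m) + P l y * (y - m) = 0\<rbrakk> \<Longrightarrow> Q k x * (h x - h m) + Q l y * (h y - h m) = 0"
    using exchange[OF e] l by blast
  obtain \<delta>2 where \<delta>2: "\<delta>2 > 0" "\<And>x. \<bar>x - e\<bar> < \<delta>2 \<Longrightarrow> x \<in> J" using ball_in_J[OF e] by blast
  define r where "r = min \<delta>1 \<delta>2"
  have r: "r > 0" "r \<le> \<delta>1" "r \<le> \<delta>2" using \<delta>1 \<delta>2 by (auto simp: r_def)
  define y where "y = e + r / 2"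
  have yJ: "y \<in> J" using r by (intro \<delta>2) (auto simp: y_def)
  \<comment> \<open>The weighted mean satisfies the balance by construction and lies strictly
    between \<open>x\<close> and \<open>y\<close>; injectivity of \<open>h\<close> then makes
    \<open>h (m x) - h x\<close> a legitimate denominator.\<close>
  define m where "m x = (P k x * x + P l y * y) / (P k x + P l y)" for x
  have m: "x \<in> J" "x < m x" "m x < y" "m x \<in> J" "P k x * (x - m x) + P l y * (y - m x) = 0"
    if "\<bar>x - e\<bar> < r / 2" for x
  proof -
    show xJ: "x \<in> J" using that r by (intro \<delta>2) auto
    have pos: "P k x > 0" "P l y > 0" using P_pos xJ yJ by auto
    have xy: "x < y" using that unfolding y_def by linarith
    have "P l y * x < P l y * y" "P k x * x < P k x * y" using xy pos by auto
    then show 1: "x < m x" "m x < y" using pos by (auto simp: m_def field_simps)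
    show "m x \<in> J" using mem_is_interval_1_I[OF interval_J xJ yJ] 1 by auto
    have "m x * (P k x + P l y) = P k x * x + P l y * y" using pos by (simp add: m_def)
    then show "P k x * (x - m x) + P l y * (y - m x) = 0" by (simp add: algebra_simps)
  qed
  have e_near: "\<bar>e - e\<bar> < r / 2" using r by simp
  have Q_eq: "Q k x = Q l y * (h y - h (m x)) / (h (m x) - h x)" if x: "\<bar>x - e\<bar> < r / 2" for x
  proof -
    have "Q k x * (h x - h (m x)) + Q l y * (h y - h (m x)) = 0"
      using r x by (intro \<delta>1 m) (auto simp: y_def)
    moreover have "h (m x) \<noteq> h x" using inj_h m[OF x] by (auto dest: inj_onD)
    ultimately show ?thesis by (simp add: field_simps)
  qed
  have "isCont m e"
    unfolding m_def using P_pos[OF e, of k] P_pos[OF yJ, of l]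
    by (intro continuous_intros isCont_P e) auto
  then have "isCont (\<lambda>x. h (m x)) e"
    by (rule isCont_o2) (intro isCont_h m e_near)
  moreover have "h (m e) \<noteq> h e" using inj_h m[OF e_near] by (auto dest: inj_onD)
  ultimately have cont: "isCont (\<lambda>x. Q l y * (h y - h (m x)) / (h (m x) - h x)) e"
    by (intro continuous_intros isCont_h e) auto
  have "\<forall>\<^sub>F x in nhds e. Q k x = Q l y * (h y - h (m x)) / (h (m x) - h x)"
    unfolding eventually_nhds_metric dist_real_def using Q_eq r by (intro exI[of _ "r/2"]) auto
  from isCont_cong[OF this] cont show ?thesis by simp
qed

text \<open>Continuity spreads the strict inequality at \<open>e\<close> to a neighbourhood, uniform
  in \<open>m\<close> and \<open>x\<close>, where \<open>balanced_partner\<close> applies. The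
  partner lies across \<open>m\<close> at distance at most \<open>C\<close> times that of
  \<open>x\<close>: a contraction if \<open>C < 1\<close>, while a larger \<open>C\<close> admits
  every pair of weights.\<close>

lemma exchange_partner:
  assumes e: "e \<in> J" and kl: "k \<noteq> l" and C: "P k e < C * P l e"
  obtains \<delta> where "\<delta> > 0" "\<And>x. \<bar>x - e\<bar> < \<delta> \<Longrightarrow> x \<in> J"
    "\<And>m x. \<bar>m - e\<bar> < \<delta> \<Longrightarrow> \<bar>x - e\<bar> < \<delta> \<Longrightarrow> \<exists>\<tau> y. 0 < \<tau> \<and> \<tau> \<le> C \<and> y = m - \<tau> * (x - m) \<and> y \<in> J \<and>
      P k x * (x - m) + P l y * (y - m) = 0 \<and> Q k x * (h x - h m) + Q l y * (h y - h m) = 0"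
proof -
  have C0: "C > 0"
    using C P_pos[OF e, of k] P_pos[OF e, of l] by (smt (verit) mult_nonpos_nonneg)
  \<comment> \<open>The separating value \<open>c\<close> is used because the two weights are
    compared at different points, \<open>x\<close> and \<open>m - C * (x - m)\<close>.\<close>
  obtain c where c: "P k e < c" "c < C * P l e" using dense[OF C] by blast
  have "\<forall>\<^sub>F x in nhds e. P k x < c"
    using isCont_P[OF e, of k] c(1) unfolding isCont_def tendsto_at_iff_tendsto_nhds
    by (rule order_tendstoD)
  moreover have "((\<lambda>x. C * P l x) \<longlongrightarrow> C * P l e) (nhds e)"
    using isCont_P[OF e, of l] unfolding isCont_def tendsto_at_iff_tendsto_nhds
    by (rule tendsto_mult_left)
  then have "\<forall>\<^sub>F x in nhds e. c < C * P l x"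
    using c(2) by (rule order_tendstoD)
  ultimately have "\<forall>\<^sub>F x in nhds e. P k x < c \<and> c < C * P l x" by eventually_elim simp
  then obtain \<delta>0 where \<delta>0: "\<delta>0 > 0" "\<And>x. \<bar>x - e\<bar> < \<delta>0 \<Longrightarrow> P k x < c \<and> c < C * P l x"
    unfolding eventually_nhds_metric dist_real_def by blast
  obtain \<delta>1 where \<delta>1: "\<delta>1 > 0" "\<And>x y m. \<lbrakk>\<bar>x - e\<bar> < \<delta>1; \<bar>y - e\<bar> < \<delta>1;
      P k x * (x - m) + P l y * (y - m) = 0\<rbrakk> \<Longrightarrow> Q k x * (h x - h m) + Q l y * (h y - h m) = 0"
    using exchange[OF e] kl by blast
  obtain \<delta>2 where \<delta>2: "\<delta>2 > 0" "\<And>x. \<bar>x - e\<bar> < \<delta>2 \<Longrightarrow> x \<in> J" using ball_in_J[OF e] by blast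
  define r where "r = Min {\<delta>0, \<delta>1, \<delta>2}"
  have r: "r > 0" "r \<le> \<delta>0" "r \<le> \<delta>1" "r \<le> \<delta>2" using \<delta>0 \<delta>1 \<delta>2 by (auto simp: r_def)
  \<comment> \<open>Since \<open>x\<close> is within \<open>2 * \<delta>\<close> of
    \<open>m\<close>, every candidate partner is within
    \<open>\<delta> + C * (2 * \<delta>) = r\<close> of \<open>e\<close>.\<close>
  define \<delta> where "\<delta> = r / (1 + 2 * C)"
  have "\<delta> > 0" "\<delta> * (1 + 2 * C) = r" using r C0 by (auto simp: \<delta>_def)
  then have \<delta>: "\<delta> > 0" "\<delta> + C * (2 * \<delta>) = r" "\<delta> \<le> r"
    using C0 by (auto simp: algebra_simps)
  show thesis
  proof (rule that[OF \<delta>(1)])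
    show "x \<in> J" if "\<bar>x - e\<bar> < \<delta>" for x using that \<delta> r \<delta>2 by simp
    fix m x assume m: "\<bar>m - e\<bar> < \<delta>" and x: "\<bar>x - e\<bar> < \<delta>"
    have near: "\<bar>m - \<tau> * (x - m) - e\<bar> < r" if "0 \<le> \<tau>" "\<tau> \<le> C" for \<tau>
    proof -
      have "\<bar>\<tau> * (x - m)\<bar> \<le> C * (2 * \<delta>)"
        unfolding abs_mult using that m x by (intro mult_mono) auto
      then show ?thesis using m \<delta> by linarith
    qed
    have seg: "closed_segment m (m - C * (x - m)) \<subseteq> J"
    proof -
      have "convex J" using interval_J by (simp add: is_interval_convex)
      moreover have "m \<in> J" "m - C * (x - m) \<in> J"
        using near[of 0] near[of C] C0 r by (auto intro!: \<delta>2)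
      ultimately show ?thesis by (simp add: closed_segment_subset)
    qed
    have xr: "\<bar>x - e\<bar> < r" using x \<delta> by simp
    have "P k x \<le> C * P l (m - C * (x - m))"
      using \<delta>0(2)[of x] \<delta>0(2)[of "m - C * (x - m)"] near[of C] C0 r xr by force
    then obtain \<tau> where \<tau>: "0 < \<tau>" "\<tau> \<le> C" "\<tau> * P l (m - \<tau> * (x - m)) = P k x"
      using balanced_partner[OF C0 P_pos continuous_on_subset[OF cont_P seg]] \<delta>2(2)[of x] xr r
      by (metis order_less_le_trans)
    define y where "y = m - \<tau> * (x - m)"
    have y: "\<bar>y - e\<bar> < r" using near[of \<tau>] \<tau> by (simp add: y_def)
    have 1: "P k x * (x - m) + P l y * (y - m) = 0"
      using \<tau>(3) unfolding y_def[symmetric] by (simp add: y_def[of] algebra_simps flip: \<tau>(3))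
    have 2: "Q k x * (h x - h m) + Q l y * (h y - h m) = 0"
      using xr y r by (intro \<delta>1 1) auto
    show "\<exists>\<tau> y. 0 < \<tau> \<and> \<tau> \<le> C \<and> y = m - \<tau> * (x - m) \<and> y \<in> J \<and>
      P k x * (x - m) + P l y * (y - m) = 0 \<and> Q k x * (h x - h m) + Q l y * (h y - h m) = 0"
      using \<tau> y r 1 2 by (intro exI[of _ \<tau>] exI[of _ y]) (auto simp: y_def intro!: \<delta>2)
  qed
qed

section \<open>Weighted difference quotients and their invariance\<close>

text \<open>The quantity preserved by passing to the partner. Division by zero gives it the value 0
  at \<open>x = m\<close>, so statements about it exclude that point.\<close>

definition weighted_quotient :: "'k \<Rightarrow> real \<Rightarrow> real \<Rightarrow> real" where
  "weighted_quotient k m x = Q k x / P k x * ((h x - h m) / (x - m))"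

lemma weighted_quotient_tendsto:
  assumes "m \<in> J" "(h has_real_derivative D) (at m)"
  shows "(weighted_quotient k m \<longlongrightarrow> Q k m / P k m * D) (at m)"
  unfolding weighted_quotient_def
  using isCont_P[of m k] isCont_Q[of m k] P_pos[of m k] assms
  by (intro tendsto_mult tendsto_divide) (auto simp: isCont_def has_field_derivative_iff)

text \<open>Each side divides a summand of the second balance by the matching summand of the first.
  Within each balance the two summands are negatives of each other, and the signs cancel.\<close>

lemma weighted_quotient_exchange:
  assumes "x \<in> J" "y \<in> J" "x \<noteq> m" "y \<noteq> m"
    and "P k x * (x - m) + P l y * (y - m) = 0"
    and "Q k x * (h x - h m) + Q l y * (h y - h m) = 0"
  shows "weighted_quotient k m x = weighted_quotient l m y"
proof -
  have "P l y * (y - m) = - (P k x * (x - m))" "Q l y * (h y - h m) = - (Q k x * (h x - h m))"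
    using assms by auto
  then show ?thesis by (simp add: weighted_quotient_def times_divide_times_eq)
qed

text \<open>As \<open>x\<close> tends to \<open>m\<close>, so does its partner, because
  \<open>\<tau>\<close> is bounded. The equal weighted quotients for \<open>k\<close> and
  \<open>l\<close> thus have the same limit, and \<open>D\<close> cancels.\<close>

lemma weight_ratio_eq:
  assumes m: "m \<in> J" and D: "(h has_real_derivative D) (at m)" "D \<noteq> 0"
  shows "Q k m / P k m = Q l m / P l m"
proof (cases "k = l")
  case False
  have pos: "P k m > 0" "P l m > 0" using P_pos m by auto
  define C where "C = 2 * P k m / P l m"
  have C: "C > 0" "P k m < C * P l m" using pos by (auto simp: C_def)
  define A where "A = Q k m / P k m * D"
  define B where "B = Q l m / P l m * D"
  have "A = B"
  proof (rule ccontr)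
    assume "A \<noteq> B"
    \<comment> \<open>Half the gap makes the \<open>\<epsilon>\<close>-neighbourhoods of
      \<open>A\<close> and \<open>B\<close> disjoint.\<close>
    define \<epsilon> where "\<epsilon> = \<bar>A - B\<bar> / 2"
    have \<epsilon>: "\<epsilon> > 0" using \<open>A \<noteq> B\<close> by (simp add: \<epsilon>_def)
    have "\<forall>\<^sub>F x in at m. \<bar>weighted_quotient k m x - A\<bar> < \<epsilon>"
      "\<forall>\<^sub>F x in at m. \<bar>weighted_quotient l m x - B\<bar> < \<epsilon>"
      using tendstoD[OF weighted_quotient_tendsto[OF m D(1)] \<epsilon>]
      unfolding A_def B_def dist_real_def by auto
    then have "\<forall>\<^sub>F x in at m. \<bar>weighted_quotient k m x - A\<bar> < \<epsilon> \<and> \<bar>weighted_quotient l m x - B\<bar> < \<epsilon>"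
      by eventually_elim simp
    then obtain \<eta> where \<eta>: "\<eta> > 0" "\<And>x. x \<noteq> m \<Longrightarrow> \<bar>x - m\<bar> < \<eta> \<Longrightarrow>
        \<bar>weighted_quotient k m x - A\<bar> < \<epsilon> \<and> \<bar>weighted_quotient l m x - B\<bar> < \<epsilon>"
      unfolding eventually_at dist_real_def by auto
    obtain \<delta> where \<delta>: "\<delta> > 0" "\<And>x. \<bar>x - m\<bar> < \<delta> \<Longrightarrow> x \<in> J"
      "\<And>x. \<bar>x - m\<bar> < \<delta> \<Longrightarrow> \<exists>\<tau> y. 0 < \<tau> \<and> \<tau> \<le> C \<and> y = m - \<tau> * (x - m) \<and> y \<in> J \<and>
        P k x * (x - m) + P l y * (y - m) = 0 \<and> Q k x * (h x - h m) + Q l y * (h y - h m) = 0"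
      using exchange_partner[OF m False C(2)] by (metis abs_zero diff_self)
    \<comment> \<open>Both \<open>m + d\<close> and its partner, at distance at most
      \<open>C * d\<close>, must fall into the \<open>\<eta>\<close>-neighbourhood of
      \<open>m\<close>.\<close>
    obtain d where d: "0 < d" "d < \<eta>" "d < \<eta> / C" "d < \<delta>"
      using dense[of 0 "Min {\<eta>, \<eta> / C, \<delta>}"] \<eta>(1) \<delta>(1) C(1) by auto
    have Cd: "C * d < \<eta>" using d(3) C(1) by (simp add: field_simps)
    obtain \<tau> y where y: "0 < \<tau>" "\<tau> \<le> C" "y = m - \<tau> * d" "y \<in> J"
      "P k (m + d) * (m + d - m) + P l y * (y - m) = 0"
      "Q k (m + d) * (h (m + d) - h m) + Q l y * (h y - h m) = 0"
      using \<delta>(3)[of "m + d"] d by auto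
    have "\<tau> * d \<le> C * d" using y d by simp
    then have "\<tau> * d < \<eta>" using Cd by simp
    then have "\<bar>y - m\<bar> < \<eta>" "y \<noteq> m" using y(1,3) d(1) by (auto simp: abs_mult)
    moreover have "weighted_quotient k m (m + d) = weighted_quotient l m y"
      using y d \<delta>(2)[of "m + d"] by (intro weighted_quotient_exchange) auto
    ultimately show False
      using \<eta>(2)[of "m + d"] \<eta>(2)[of y] d unfolding \<epsilon>_def by (simp add: abs_if split: if_splits)
  qed
  then show ?thesis using D(2) unfolding A_def B_def by (simp only: mult_cancel_right) simp
qed simp

text \<open>When \<open>P k < P l\<close> near \<open>e\<close>, passing from \<open>x\<close> to its partner \<open>y\<close> contracts towards \<open>m\<close> and
  preserves the weighted quotient, which therefore equals its limit at \<open>m\<close>.\<close>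

lemma weighted_quotient_const:
  assumes e: "e \<in> J0" and J0: "open J0" "J0 \<subseteq> J"
    and der: "\<And>z. z \<in> J0 \<Longrightarrow> \<exists>D. D \<noteq> 0 \<and> (h has_real_derivative D) (at z)"
    and less: "P k e < P l e"
  obtains \<delta> where "\<delta> > 0" "\<And>x. \<bar>x - e\<bar> < \<delta> \<Longrightarrow> x \<in> J0"
    "\<And>m. \<bar>m - e\<bar> < \<delta> \<Longrightarrow> \<exists>\<kappa>. \<forall>x. \<bar>x - e\<bar> < \<delta> \<and> x \<noteq> m \<longrightarrow> weighted_quotient k m x = \<kappa>"
proof -
  have eJ: "e \<in> J" using e J0 by auto
  have kl: "k \<noteq> l" using less by auto
  have pos: "P k e > 0" "P l e > 0" using P_pos eJ by auto
  \<comment> \<open>The lower bound on \<open>C\<close> provides partners, the upper bound makes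
    them contract.\<close>
  obtain C where C: "P k e / P l e < C" "C < 1"
    using dense[of "P k e / P l e" 1] less pos by auto
  have C0: "C > 0" using C(1) pos by (smt (verit) divide_pos_pos)
  have "P k e < C * P l e" using C(1) pos by (simp add: field_simps)
  from exchange_partner[OF eJ kl this] obtain \<delta>1 where \<delta>1: "\<delta>1 > 0" "\<And>x. \<bar>x - e\<bar> < \<delta>1 \<Longrightarrow> x \<in> J"
    "\<And>m x. \<bar>m - e\<bar> < \<delta>1 \<Longrightarrow> \<bar>x - e\<bar> < \<delta>1 \<Longrightarrow> \<exists>\<tau> y. 0 < \<tau> \<and> \<tau> \<le> C \<and> y = m - \<tau> * (x - m) \<and> y \<in> J \<and>
      P k x * (x - m) + P l y * (y - m) = 0 \<and> Q k x * (h x - h m) + Q l y * (h y - h m) = 0"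
    by metis
  obtain \<delta>2 where \<delta>2: "\<delta>2 > 0" "\<And>x. \<bar>x - e\<bar> < \<delta>2 \<Longrightarrow> x \<in> J0"
    using J0(1) e unfolding open_dist dist_real_def by blast
  \<comment> \<open>Points within \<open>2 * \<delta>\<close> of \<open>m\<close> are within
    \<open>3 * \<delta>\<close> of \<open>e\<close>; the contraction keeps all iterates
    there.\<close>
  define \<delta> where "\<delta> = min \<delta>1 \<delta>2 / 3"
  have \<delta>: "\<delta> > 0" "3 * \<delta> \<le> \<delta>1" "3 * \<delta> \<le> \<delta>2" using \<delta>1(1) \<delta>2(1) by (auto simp: \<delta>_def)
  show thesis
  proof (rule that[OF \<delta>(1)])
    show "x \<in> J0" if "\<bar>x - e\<bar> < \<delta>" for x using that \<delta> by (intro \<delta>2) auto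
    fix m assume m: "\<bar>m - e\<bar> < \<delta>"
    have mJ0: "m \<in> J0" using m \<delta> by (intro \<delta>2) auto
    then have mJ: "m \<in> J" using J0 by auto
    obtain D where D: "D \<noteq> 0" "(h has_real_derivative D) (at m)" using der[OF mJ0] by blast
    define L where "L = Q k m / P k m * D"
    have next_point: "\<exists>y. y \<noteq> m \<and> \<bar>y - m\<bar> \<le> C * \<bar>x - m\<bar> \<and> weighted_quotient k m x = weighted_quotient k m y"
      if x: "x \<noteq> m" "\<bar>x - m\<bar> < 2 * \<delta>" for x
    proof -
      have xe: "\<bar>x - e\<bar> < 3 * \<delta>" using x m by linarith
      then have xJ: "x \<in> J" using \<delta> by (intro \<delta>1(2)) auto
      have "\<bar>m - e\<bar> < \<delta>1" "\<bar>x - e\<bar> < \<delta>1" using xe m \<delta> by auto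
      then obtain \<tau> y where y: "0 < \<tau>" "\<tau> \<le> C" "y = m - \<tau> * (x - m)" "y \<in> J"
        "P k x * (x - m) + P l y * (y - m) = 0" "Q k x * (h x - h m) + Q l y * (h y - h m) = 0"
        using \<delta>1(3) by metis
      have ym: "\<bar>y - m\<bar> = \<tau> * \<bar>x - m\<bar>" using y(1,3) by (simp add: abs_mult)
      have y_ne: "y \<noteq> m" using y(1,3) x(1) by simp
      have y_le: "\<bar>y - m\<bar> \<le> C * \<bar>x - m\<bar>" unfolding ym using y(2) by (intro mult_right_mono) auto
      have "C * \<bar>x - m\<bar> \<le> 1 * \<bar>x - m\<bar>" using C by (intro mult_right_mono) auto
      then have "\<bar>y - m\<bar> < 2 * \<delta>" using y_le x(2) by simp
      then have "\<bar>y - e\<bar> < 3 * \<delta>" using m by linarith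
      then have "y \<in> J0" using \<delta> by (intro \<delta>2) auto
      \<comment> \<open>Equal ratios at \<open>y\<close> turn the index \<open>l\<close> back into
        \<open>k\<close>, so that the passage to the partner can be iterated.\<close>
      then have "Q l y / P l y = Q k y / P k y" using weight_ratio_eq[OF y(4)] der by metis
      then have "weighted_quotient l m y = weighted_quotient k m y"
        by (simp only: weighted_quotient_def)
      moreover have "weighted_quotient k m x = weighted_quotient l m y"
        by (rule weighted_quotient_exchange[OF xJ y(4) x(1) y_ne y(5,6)])
      ultimately show ?thesis using y_ne y_le by metis
    qed
    have close: "\<bar>weighted_quotient k m x - L\<bar> < \<epsilon>"
      if "\<epsilon> > 0" and x: "x \<noteq> m" "\<bar>x - m\<bar> < 2 * \<delta>" for \<epsilon> x
    proof -
      have "\<forall>\<^sub>F x in at m. \<bar>weighted_quotient k m x - L\<bar> < \<epsilon>"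
        using tendstoD[OF weighted_quotient_tendsto[OF mJ D(2)] \<open>\<epsilon> > 0\<close>]
        unfolding L_def dist_real_def by auto
      then obtain \<eta> where \<eta>: "\<eta> > 0" "\<And>x. x \<noteq> m \<Longrightarrow> \<bar>x - m\<bar> < \<eta> \<Longrightarrow> \<bar>weighted_quotient k m x - L\<bar> < \<epsilon>"
        unfolding eventually_at dist_real_def by auto
      \<comment> \<open>After \<open>n\<close> passages the point is within
        \<open>C ^ n * \<bar>x - m\<bar>\<close> of \<open>m\<close>, where the quotient is close to
        its limit, yet the quotient has not changed.\<close>
      have iter: "\<bar>weighted_quotient k m x - L\<bar> < \<epsilon>"
        if "x \<noteq> m" "\<bar>x - m\<bar> < 2 * \<delta>" "C ^ n * \<bar>x - m\<bar> < \<eta>" for n x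
        using that
      proof (induction n arbitrary: x)
        case 0
        then show ?case using \<eta>(2) by simp
      next
        case (Suc n)
        obtain y where y: "y \<noteq> m" "\<bar>y - m\<bar> \<le> C * \<bar>x - m\<bar>"
          "weighted_quotient k m x = weighted_quotient k m y"
          using next_point Suc.prems by blast
        have "C * \<bar>x - m\<bar> \<le> 1 * \<bar>x - m\<bar>" using C by (intro mult_right_mono) auto
        then have "\<bar>y - m\<bar> < 2 * \<delta>" using y(2) Suc.prems(2) by simp
        moreover have "C ^ n * \<bar>y - m\<bar> \<le> C ^ n * (C * \<bar>x - m\<bar>)"
          using y C0 by (intro mult_left_mono) auto
        then have "C ^ n * \<bar>y - m\<bar> < \<eta>" using Suc.prems by (simp add: mult_ac)
        ultimately show ?case using Suc.IH[OF y(1)] y(3) by simp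
      qed
      obtain n where "C ^ n < \<eta> / \<bar>x - m\<bar>"
        using real_arch_pow_inv[of "\<eta> / \<bar>x - m\<bar>" C] \<eta>(1) C(2) x(1) by auto
      then have "C ^ n * \<bar>x - m\<bar> < \<eta>" using x(1) by (simp add: field_simps)
      then show ?thesis using iter x by blast
    qed
    have "weighted_quotient k m x = L" if "\<bar>x - e\<bar> < \<delta>" "x \<noteq> m" for x
    proof (rule ccontr)
      assume "weighted_quotient k m x \<noteq> L"
      moreover have "\<bar>x - m\<bar> < 2 * \<delta>" using that(1) m by linarith
      ultimately show False using close[of "\<bar>weighted_quotient k m x - L\<bar>" x] that(2) by simp
    qed
    then show "\<exists>\<kappa>. \<forall>x. \<bar>x - e\<bar> < \<delta> \<and> x \<noteq> m \<longrightarrow> weighted_quotient k m x = \<kappa>" by blast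
  qed
qed

section \<open>The Moebius representation near a point\<close>

text \<open>Division-free form, linear in \<open>Q k x\<close> and \<open>Q k x * h x\<close>: it
  passes to limits and can be read off a linear system. Positive weights give back the fractional
  form of \<open>h\<close>.\<close>

definition moebius_at :: "real \<Rightarrow> real \<Rightarrow> real \<Rightarrow> real \<Rightarrow> real \<Rightarrow> bool" where
  "moebius_at a b c d x \<longleftrightarrow>
     (\<forall>k. Q k x = (c * x + d) * P k x \<and> Q k x * h x = (a * x + b) * P k x)"

text \<open>For the base points \<open>e\<close> and \<open>m\<close>, constancy of the weighted
  quotient makes \<open>w x * (h x - h e)\<close> and \<open>w x * (h x - h m)\<close> affine in
  \<open>x\<close>. Their difference shows that \<open>w\<close> is affine, and then so is
  \<open>w * h\<close>.\<close>

lemma moebius_near: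
  assumes e: "e \<in> J0" and J0: "open J0" "J0 \<subseteq> J"
    and der: "\<And>z. z \<in> J0 \<Longrightarrow> \<exists>D. D \<noteq> 0 \<and> (h has_real_derivative D) (at z)"
    and less: "P k e < P l e"
  obtains a b c d \<delta> where "\<delta> > 0" "\<And>x. \<bar>x - e\<bar> < \<delta> \<Longrightarrow> x \<in> J \<and> moebius_at a b c d x"
proof -
  obtain \<delta> where \<delta>: "\<delta> > 0" "\<And>x. \<bar>x - e\<bar> < \<delta> \<Longrightarrow> x \<in> J0"
    "\<And>m. \<bar>m - e\<bar> < \<delta> \<Longrightarrow> \<exists>\<kappa>. \<forall>x. \<bar>x - e\<bar> < \<delta> \<and> x \<noteq> m \<longrightarrow> weighted_quotient k m x = \<kappa>"
    using weighted_quotient_const[OF assms] by metis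
  define w where "w x = Q k x / P k x" for x
  have affine: "\<exists>\<kappa>. \<forall>x. \<bar>x - e\<bar> < \<delta> \<longrightarrow> w x * (h x - h m) = \<kappa> * (x - m)"
    if m: "\<bar>m - e\<bar> < \<delta>" for m
  proof -
    obtain \<kappa> where \<kappa>: "\<And>x. \<bar>x - e\<bar> < \<delta> \<Longrightarrow> x \<noteq> m \<Longrightarrow> weighted_quotient k m x = \<kappa>"
      using \<delta>(3)[OF m] by blast
    have "w x * (h x - h m) = \<kappa> * (x - m)" if "\<bar>x - e\<bar> < \<delta>" for x
    proof (cases "x = m")
      case False
      have "P k x > 0" using \<delta>(2)[OF that] J0 P_pos by auto
      then show ?thesis
        using \<kappa>[OF that False] False unfolding weighted_quotient_def w_def
        by (simp add: field_simps)
    qed simp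
    then show ?thesis by blast
  qed
  define m where "m = e + \<delta> / 2"
  have m: "\<bar>m - e\<bar> < \<delta>" "m \<noteq> e" using \<delta>(1) by (auto simp: m_def)
  obtain \<kappa>0 where \<kappa>0: "\<And>x. \<bar>x - e\<bar> < \<delta> \<Longrightarrow> w x * (h x - h e) = \<kappa>0 * (x - e)"
    using affine[of e] \<delta>(1) by auto
  obtain \<kappa>1 where \<kappa>1: "\<And>x. \<bar>x - e\<bar> < \<delta> \<Longrightarrow> w x * (h x - h m) = \<kappa>1 * (x - m)"
    using affine[of m] m by auto
  have hm: "h m - h e \<noteq> 0"
    using inj_h m \<delta>(2)[OF m(1)] e J0 by (auto dest: inj_onD)
  \<comment> \<open>Coefficients of \<open>w\<close>, from the difference of the
    \<open>\<kappa>0\<close> and \<open>\<kappa>1\<close> equations; \<open>a\<close> and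
    \<open>b\<close> below come from the \<open>\<kappa>0\<close> equation alone.\<close>
  define c where "c = (\<kappa>0 - \<kappa>1) / (h m - h e)"
  define d where "d = (\<kappa>1 * m - \<kappa>0 * e) / (h m - h e)"
  define a where "a = c * h e + \<kappa>0"
  define b where "b = d * h e - \<kappa>0 * e"
  have *: "w x = c * x + d" "w x * h x = a * x + b" if x: "\<bar>x - e\<bar> < \<delta>" for x
  proof -
    have "w x * (h m - h e) = \<kappa>0 * (x - e) - \<kappa>1 * (x - m)"
      using \<kappa>0[OF x] \<kappa>1[OF x] by (simp add: algebra_simps)
    also have "\<dots> = (c * (h m - h e)) * x + d * (h m - h e)"
      using hm by (simp add: c_def d_def) (simp add: algebra_simps)
    also have "\<dots> = (c * x + d) * (h m - h e)" by (simp add: algebra_simps)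
    finally show 1: "w x = c * x + d" using hm by simp
    have "w x * h x = w x * h e + \<kappa>0 * (x - e)" using \<kappa>0[OF x] by (simp add: algebra_simps)
    then show "w x * h x = a * x + b" by (simp add: 1 a_def b_def algebra_simps)
  qed
  show thesis
  proof (rule that[OF \<delta>(1)])
    fix x assume x: "\<bar>x - e\<bar> < \<delta>"
    have xJ: "x \<in> J" "x \<in> J0" using \<delta>(2)[OF x] J0 by auto
    \<comment> \<open>The factor \<open>w\<close> was found for the index \<open>k\<close> only;
      equality of the ratios carries it to every index.\<close>
    have Q: "Q r x = w x * P r x" for r
    proof -
      have "Q r x / P r x = w x" unfolding w_def
        using weight_ratio_eq[OF xJ(1)] der[OF xJ(2)] by metis
      then show ?thesis using P_pos[OF xJ(1), of r] by (simp add: field_simps)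
    qed
    have "Q r x * h x = (w x * h x) * P r x" for r by (simp add: Q)
    then show "x \<in> J \<and> moebius_at a b c d x"
      unfolding moebius_at_def using xJ(1) Q *[OF x] by simp
  qed
qed

section \<open>Propagation over the whole interval\<close>

text \<open>Both defining equations say that a function continuous at \<open>e\<close> vanishes, so
  they survive the limit. The sign \<open>s\<close> treats propagation to the right and to the left
  at once.\<close>

lemma moebius_at_limit:
  assumes e: "e \<in> J" and s: "\<bar>s\<bar> = 1" and "0 < \<eta>"
    and good: "\<And>\<tau>. 0 < \<tau> \<Longrightarrow> \<tau> < \<eta> \<Longrightarrow> moebius_at a b c d (e - s * \<tau>)"
  shows "moebius_at a b c d e"
proof -
  have lim: "((\<lambda>\<tau>. \<phi> (e - s * \<tau>)) \<longlongrightarrow> \<phi> e) (at_right 0)" if "isCont \<phi> e" for \<phi> :: "real \<Rightarrow> real"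
  proof (rule isCont_tendsto_compose[OF that])
    have "((\<lambda>\<tau>. e - s * \<tau>) \<longlongrightarrow> e - s * 0) (at_right 0)" by (intro tendsto_intros)
    then show "((\<lambda>\<tau>. e - s * \<tau>) \<longlongrightarrow> e) (at_right 0)" by simp
  qed
  have ev: "\<forall>\<^sub>F \<tau> in at_right 0. moebius_at a b c d (e - s * \<tau>)"
    using good \<open>0 < \<eta>\<close> unfolding eventually_at_right_field by auto
  have zero: "\<phi> e = 0"
    if "isCont \<phi> e" "\<And>x. moebius_at a b c d x \<Longrightarrow> \<phi> x = 0" for \<phi> :: "real \<Rightarrow> real"
  proof -
    have "\<forall>\<^sub>F \<tau> in at_right 0. \<phi> (e - s * \<tau>) = 0" using ev by eventually_elim (rule that(2))
    then have "((\<lambda>\<tau>. \<phi> (e - s * \<tau>)) \<longlongrightarrow> 0) (at_right 0)" by (rule tendsto_eventually)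
    then show ?thesis using tendsto_unique[OF _ lim[OF that(1)]] by simp
  qed
  show ?thesis unfolding moebius_at_def
  proof
    fix k
    note [continuous_intros] = isCont_Q[OF e] isCont_P[OF e] isCont_h[OF e]
    have "Q k e - (c * e + d) * P k e = 0"
      by (rule zero, intro continuous_intros) (auto simp: moebius_at_def)
    moreover have "Q k e * h e - (a * e + b) * P k e = 0"
      by (rule zero, intro continuous_intros) (metis moebius_at_def right_minus_eq)
    ultimately show "Q k e = (c * e + d) * P k e \<and> Q k e * h e = (a * e + b) * P k e" by simp
  qed
qed

text \<open>The exchange relation around \<open>r\<close> between \<open>y\<close> and a point \<open>t\<close> where the representation is
  known is linear in the unknowns \<open>Q k y\<close> and \<open>Q k y * h y\<close>; two choices of \<open>r\<close> determine them.\<close>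

lemma moebius_exchange:
  assumes r: "moebius_at a b c d r" "r \<in> J" and t: "moebius_at a b c d t"
    and P: "P k y * (y - r) + P l t * (t - r) = 0"
    and Q: "Q k y * (h y - h r) + Q l t * (h t - h r) = 0"
  shows "Q k y * h y - (a * y + b) * P k y = h r * (Q k y - (c * y + d) * P k y)"
proof -
  have r_eq: "(c * r + d) * h r = a * r + b" and r_nz: "c * r + d \<noteq> 0"
  proof -
    have *: "Q k r = (c * r + d) * P k r" "Q k r * h r = (a * r + b) * P k r"
      using r(1) unfolding moebius_at_def by blast+
    then show "c * r + d \<noteq> 0" using Q_pos[OF r(2), of k] by auto
    have "((c * r + d) * h r) * P k r = (a * r + b) * P k r"
      using *(2) unfolding *(1) by (simp add: mult_ac)
    then show "(c * r + d) * h r = a * r + b" using P_pos[OF r(2), of k] by simp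
  qed
  have tQ: "Q l t = (c * t + d) * P l t" "Q l t * h t = (a * t + b) * P l t"
    using t unfolding moebius_at_def by blast+
  have "Q k y * h y - h r * Q k y = - (Q l t * h t - Q l t * h r)" using Q by (simp add: algebra_simps)
  \<comment> \<open>The factor \<open>c * r + d\<close> replaces \<open>h r\<close> by
    \<open>a * r + b\<close>. Then \<open>a * d - b * c\<close> factors out, and the balance
    exchanges \<open>P l t * (t - r)\<close> for \<open>P k y * (y - r)\<close>.\<close>
  then have "(c * r + d) * (Q k y * h y - h r * Q k y) =
      - ((c * r + d) * (Q l t * h t) - Q l t * ((c * r + d) * h r))"
    by (simp only:) (simp add: algebra_simps)
  also have "\<dots> = (a * d - b * c) * (- (P l t * (t - r)))"
    unfolding r_eq tQ(2) unfolding tQ(1) by (simp add: algebra_simps)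
  also have "- (P l t * (t - r)) = P k y * (y - r)" using P by simp
  also have "(a * d - b * c) * (P k y * (y - r)) =
      (c * r + d) * ((a * y + b) * P k y) - (a * r + b) * ((c * y + d) * P k y)"
    by (simp add: algebra_simps)
  also have "\<dots> = (c * r + d) * ((a * y + b) * P k y - h r * ((c * y + d) * P k y))"
    unfolding r_eq[symmetric] by (simp add: algebra_simps)
  finally have "Q k y * h y - h r * Q k y = (a * y + b) * P k y - h r * ((c * y + d) * P k y)"
    using r_nz by simp
  then show ?thesis by (simp add: algebra_simps)
qed

text \<open>The new point \<open>y = e + s * \<tau>\<close> is paired around centres
  \<open>e - s * u\<close> on the known side, so its partner \<open>t\<close> lies there too and
  \<open>moebius_exchange\<close> applies. The centres \<open>u = 0\<close> and
  \<open>u = \<tau>\<close> give two independent equations.\<close>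

lemma moebius_at_step:
  assumes e: "e \<in> J" and s: "\<bar>s\<bar> = 1" and \<eta>: "0 < \<eta>"
    and good: "\<And>\<tau>. 0 \<le> \<tau> \<Longrightarrow> \<tau> < \<eta> \<Longrightarrow> moebius_at a b c d (e - s * \<tau>)"
  obtains \<eta>' where "0 < \<eta>'" "\<And>\<tau>. 0 < \<tau> \<Longrightarrow> \<tau> < \<eta>' \<Longrightarrow> moebius_at a b c d (e + s * \<tau>)"
proof -
  have "\<forall>\<^sub>F \<tau> in at_right 0. Q k (e + s * \<tau>) = (c * (e + s * \<tau>) + d) * P k (e + s * \<tau>) \<and>
      Q k (e + s * \<tau>) * h (e + s * \<tau>) = (a * (e + s * \<tau>) + b) * P k (e + s * \<tau>)" for k
  proof -
    obtain l where l: "k \<noteq> l" using two_indices[of k] by metis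
    have pos: "P k e > 0" "P l e > 0" using P_pos e by auto
    define C where "C = 2 * P k e / P l e"
    have C: "C > 0" "P k e < C * P l e" using pos by (auto simp: C_def)
    from exchange_partner[OF e l C(2)] obtain \<delta> where \<delta>: "\<delta> > 0" "\<And>x. \<bar>x - e\<bar> < \<delta> \<Longrightarrow> x \<in> J"
      "\<And>m x. \<bar>m - e\<bar> < \<delta> \<Longrightarrow> \<bar>x - e\<bar> < \<delta> \<Longrightarrow> \<exists>\<tau> y. 0 < \<tau> \<and> \<tau> \<le> C \<and> y = m - \<tau> * (x - m) \<and> y \<in> J \<and>
        P k x * (x - m) + P l y * (y - m) = 0 \<and> Q k x * (h x - h m) + Q l y * (h y - h m) = 0"
      by metis
    \<comment> \<open>This gives \<open>\<tau> + 2 * (C * \<tau>) < \<eta>\<close>, so that the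
      partner of \<open>y\<close> stays in the known region.\<close>
    define \<eta>' where "\<eta>' = min \<delta> (\<eta> / (1 + 2 * C))"
    have \<eta>': "\<eta>' > 0" using \<delta> \<eta> C by (simp add: \<eta>'_def)
    show ?thesis
      unfolding eventually_at_right_field
    proof (intro exI[of _ \<eta>'] conjI allI impI \<eta>')
      fix \<tau> assume \<tau>: "0 < \<tau>" "\<tau> < \<eta>'"
      have "\<tau> < \<delta>" "\<tau> < \<eta> / (1 + 2 * C)" using \<tau> by (auto simp: \<eta>'_def)
      then have \<tau>_le: "\<tau> < \<delta>" "\<tau> + 2 * (C * \<tau>) < \<eta>" using C(1) by (auto simp: field_simps)
      define y where "y = e + s * \<tau>"
      define X where "X = Q k y * h y - (a * y + b) * P k y"
      define Y where "Y = Q k y - (c * y + d) * P k y"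
      have abs_s: "\<bar>s * u\<bar> = \<bar>u\<bar>" for u using s by (simp add: abs_mult)
      have X: "X = h (e - s * u) * Y" and uJ: "e - s * u \<in> J" if u: "0 \<le> u" "u \<le> \<tau>" for u
      proof -
        have near: "\<bar>e - s * u - e\<bar> < \<delta>" "\<bar>y - e\<bar> < \<delta>"
          using u \<tau> \<tau>_le by (auto simp: y_def abs_s)
        show uJ: "e - s * u \<in> J" by (rule \<delta>(2)[OF near(1)])
        obtain \<sigma> t where \<sigma>: "0 < \<sigma>" "\<sigma> \<le> C" and t: "t = e - s * u - \<sigma> * (y - (e - s * u))" "t \<in> J"
          "P k y * (y - (e - s * u)) + P l t * (t - (e - s * u)) = 0"
          "Q k y * (h y - h (e - s * u)) + Q l t * (h t - h (e - s * u)) = 0"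
          using \<delta>(3)[OF near] by metis
        have t_eq: "t = e - s * (u + \<sigma> * (\<tau> + u))" by (simp add: t(1) y_def algebra_simps)
        have "\<sigma> * (\<tau> + u) \<le> C * (\<tau> + \<tau>)" using \<sigma> u \<tau> C by (intro mult_mono) auto
        then have lt: "u + \<sigma> * (\<tau> + u) < \<eta>" using u \<tau>_le by (simp add: algebra_simps)
        have "0 \<le> \<sigma> * (\<tau> + u)" using \<sigma> u \<tau> by simp
        then have "moebius_at a b c d t" "moebius_at a b c d (e - s * u)"
          unfolding t_eq using lt u by (auto intro!: good)
        then show "X = h (e - s * u) * Y"
          using moebius_exchange[OF _ uJ _ t(3,4)] unfolding X_def Y_def by blast
      qed
      \<comment> \<open>The system \<open>X = h e * Y\<close>,
        \<open>X = h (e - s * \<tau>) * Y\<close> is nonsingular because \<open>h\<close> is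
        injective; hence \<open>X = Y = 0\<close>.\<close>
      have "e - s * \<tau> \<noteq> e" using s \<tau> by auto
      then have "h (e - s * \<tau>) \<noteq> h e" using inj_h uJ[of \<tau>] e \<tau> by (auto dest: inj_onD)
      moreover have "h (e - s * \<tau>) * Y = h e * Y" using X[of 0] X[of \<tau>] \<tau> by simp
      ultimately have "Y = 0" by simp
      moreover have "X = 0" using X[of 0] \<tau> \<open>Y = 0\<close> by simp
      ultimately show "Q k (e + s * \<tau>) = (c * (e + s * \<tau>) + d) * P k (e + s * \<tau>)"
        "Q k (e + s * \<tau>) * h (e + s * \<tau>) = (a * (e + s * \<tau>) + b) * P k (e + s * \<tau>)"
        by (auto simp: X_def Y_def y_def)
    qed
  qed
  \<comment> \<open>The neighbourhood depends on \<open>k\<close>; finitely many indices allow a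
    common one.\<close>
  then have "\<forall>\<^sub>F \<tau> in at_right 0. moebius_at a b c d (e + s * \<tau>)"
    unfolding moebius_at_def by (rule eventually_all_finite)
  then show thesis unfolding eventually_at_right_field using that by auto
qed

text \<open>Continuation along the segment from \<open>e\<close> to \<open>v\<close>, which stays in
  the interval \<open>J\<close>: limits supply closedness, \<open>moebius_at_step\<close> the
  advance.\<close>

lemma moebius_everywhere:
  assumes e: "\<epsilon> > 0" "\<And>x. \<bar>x - e\<bar> < \<epsilon> \<Longrightarrow> x \<in> J \<and> moebius_at a b c d x" and v: "v \<in> J"
  shows "moebius_at a b c d v"
proof -
  define s where "s = (if e \<le> v then 1 else - 1 :: real)"
  define T where "T = \<bar>v - e\<bar>"
  have s: "\<bar>s\<bar> = 1" by (simp add: s_def)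
  have v_eq: "v = e + s * T" by (simp add: s_def T_def)
  have eJ: "e \<in> J" using e by simp
  have inJ: "e + s * t \<in> J" if "0 \<le> t" "t \<le> T" for t
    using mem_is_interval_1_I[OF interval_J eJ v, of "e + s * t"]
      mem_is_interval_1_I[OF interval_J v eJ, of "e + s * t"] that
    by (auto simp: s_def T_def split: if_splits)
  have "moebius_at a b c d (e + s * T)"
  proof (rule real_continuation[of \<epsilon> "\<lambda>t. moebius_at a b c d (e + s * t)"])
    show "\<epsilon> > 0" by fact
    show "moebius_at a b c d (e + s * t)" if "0 \<le> t" "t < \<epsilon>" for t
      using e(2)[of "e + s * t"] that s by (auto simp: abs_mult)
    show "moebius_at a b c d (e + s * t)"
      if t: "0 < t" "t \<le> T" and below: "\<And>u. 0 \<le> u \<Longrightarrow> u < t \<Longrightarrow> moebius_at a b c d (e + s * u)" for t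
    proof (rule moebius_at_limit[OF inJ s t(1)])
      show "moebius_at a b c d (e + s * t - s * \<tau>)" if "0 < \<tau>" "\<tau> < t" for \<tau>
        using below[of "t - \<tau>"] that by (simp add: algebra_simps)
    qed (use t in auto)
    show "\<exists>\<eta>>0. \<forall>u. t < u \<and> u < t + \<eta> \<longrightarrow> moebius_at a b c d (e + s * u)"
      if t: "0 < t" "t < T" and below: "\<And>u. 0 \<le> u \<Longrightarrow> u \<le> t \<Longrightarrow> moebius_at a b c d (e + s * u)" for t
    proof -
      have tJ: "e + s * t \<in> J" using t by (intro inJ) auto
      have "moebius_at a b c d (e + s * t - s * \<tau>)" if "0 \<le> \<tau>" "\<tau> < t" for \<tau>
        using below[of "t - \<tau>"] that by (simp add: algebra_simps)
      then obtain \<eta> where \<eta>: "\<eta> > 0" "\<And>\<tau>. 0 < \<tau> \<Longrightarrow> \<tau> < \<eta> \<Longrightarrow> moebius_at a b c d (e + s * t + s * \<tau>)"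
        using moebius_at_step[OF tJ s t(1)] by metis
      have "moebius_at a b c d (e + s * u)" if "t < u" "u < t + \<eta>" for u
        using \<eta>(2)[of "u - t"] that by (simp add: algebra_simps)
      then show ?thesis using \<eta>(1) by blast
    qed
    show "0 \<le> T" by (simp add: T_def)
  qed
  then show ?thesis by (simp add: v_eq)
qed

text \<open>The coefficients found near \<open>e\<close> serve on all of \<open>J\<close>;
  positivity of \<open>P\<close> and \<open>Q\<close> forces \<open>c * x + d > 0\<close> and
  permits division. A vanishing determinant would make \<open>h\<close> constant, against
  injectivity.\<close>

theorem moebius_representation:
  assumes e: "e \<in> J0" and J0: "open J0" "J0 \<subseteq> J"
    and der: "\<And>z. z \<in> J0 \<Longrightarrow> \<exists>D. D \<noteq> 0 \<and> (h has_real_derivative D) (at z)"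
    and ne: "P k e \<noteq> P l e"
  obtains a b c d where "a * d \<noteq> b * c"
    "\<And>x. x \<in> J \<Longrightarrow> c * x + d > 0 \<and> h x = (a * x + b) / (c * x + d) \<and> (\<forall>k. Q k x = (c * x + d) * P k x)"
proof -
  obtain k' l' where "P k' e < P l' e" using ne by (metis linorder_neqE)
  from moebius_near[OF e J0 der this] obtain a b c d \<delta> where
    \<delta>: "\<delta> > 0" "\<And>x. \<bar>x - e\<bar> < \<delta> \<Longrightarrow> x \<in> J \<and> moebius_at a b c d x" by metis
  have rep: "c * x + d > 0 \<and> h x = (a * x + b) / (c * x + d) \<and> (\<forall>k. Q k x = (c * x + d) * P k x)"
    if x: "x \<in> J" for x
  proof -
    have mx: "\<And>k. Q k x = (c * x + d) * P k x" "\<And>k. Q k x * h x = (a * x + b) * P k x"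
      using moebius_everywhere[OF \<delta> x] unfolding moebius_at_def by blast+
    have P: "P k x > 0" using P_pos x by auto
    have pos: "c * x + d > 0" using mx(1)[of k] Q_pos[OF x, of k] P by (simp add: zero_less_mult_iff)
    have "((c * x + d) * h x) * P k x = (a * x + b) * P k x"
      using mx(2)[of k] unfolding mx(1) by (simp add: mult_ac)
    then have "(c * x + d) * h x = a * x + b" using P by simp
    then show ?thesis using pos mx(1) by (simp add: field_simps)
  qed
  have "a * d \<noteq> b * c"
  proof
    assume eq: "a * d = b * c"
    define x where "x = e + \<delta> / 2"
    have x: "x \<in> J" "x \<noteq> e" and eJ: "e \<in> J" using \<delta>(1) \<delta>(2)[of x] e J0 by (auto simp: x_def)
    have "(a * x + b) * (c * e + d) - (a * e + b) * (c * x + d) = (a * d - b * c) * (x - e)"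
      by (simp add: algebra_simps)
    then have "h x = h e" using rep[OF x(1)] rep[OF eJ] eq by (simp add: frac_eq_eq)
    then show False using inj_h x eJ by (auto dest: inj_onD)
  qed
  then show thesis using rep by (rule that)
qed

end

section \<open>Means as zeros of weighted sums\<close>

lemma strictly_monotone_on_imp_inj_on:
  assumes "strictly_monotone_on I f" shows "inj_on f I"
  using assms unfolding strictly_monotone_on_def
  by (auto intro!: inj_onI simp: monotone_on_def) (metis linorder_neqE less_irrefl)+

lemma weighted_average_in_interval:
  fixes w x :: "'n::finite \<Rightarrow> real"
  assumes S: "is_interval S" and w: "\<And>k. w k > 0" and x: "\<And>k. x k \<in> S"
  shows "(\<Sum>k\<in>UNIV. w k * x k) / (\<Sum>k\<in>UNIV. w k) \<in> S"
proof -
  have W: "(\<Sum>k\<in>UNIV. w k) > 0" using w by (intro sum_pos) auto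
  have "(\<Sum>k\<in>UNIV. (w k / (\<Sum>k\<in>UNIV. w k)) *\<^sub>R x k) \<in> S"
    using S W w x by (intro convex_sum) (auto simp: is_interval_convex less_imp_le simp flip: sum_divide_distrib)
  then show ?thesis by (simp add: sum_divide_distrib)
qed

context
  fixes I :: "real set" and f :: "real \<Rightarrow> real" and p :: "real \<Rightarrow> real ^ 'n"
  assumes I: "is_interval I" and f: "strictly_monotone_on I f" "continuous_on I f"
    and p: "\<forall>x\<in>I. \<forall>k. p x $ k > 0"
begin

lemma bajraktarevic_mean_eq_inv_into:
  assumes "x \<in> cube I"
  shows "(\<Sum>i\<in>UNIV. p (x $ i) $ i * f (x $ i)) / (\<Sum>i\<in>UNIV. p (x $ i) $ i) \<in> f ` I" (is ?in_image)
    and "bajraktarevic_mean I f p x = inv_into I f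
      ((\<Sum>i\<in>UNIV. p (x $ i) $ i * f (x $ i)) / (\<Sum>i\<in>UNIV. p (x $ i) $ i))" (is ?inverse)
proof -
  have "is_interval (f ` I)"
    using I f(2) by (simp add: is_interval_connected_1 connected_continuous_image)
  then show ?in_image
    using assms p by (intro weighted_average_in_interval) (auto simp: cube_def)
  then show ?inverse
    by (simp add: bajraktarevic_mean_def gen_left_inverse_eq_inv_into[OF I f(2,1)])
qed

lemma bajraktarevic_mean_in: "x \<in> cube I \<Longrightarrow> bajraktarevic_mean I f p x \<in> I"
  by (simp add: bajraktarevic_mean_eq_inv_into inv_into_into)

text \<open>Apply \<open>f\<close> and clear the positive denominator. The inverse function
  disappears, leaving an equation linear in the weights.\<close>

lemma bajraktarevic_mean_eq_iff:
  assumes x: "x \<in> cube I" and m: "m \<in> I"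
  shows "bajraktarevic_mean I f p x = m \<longleftrightarrow> (\<Sum>i\<in>UNIV. p (x $ i) $ i * (f (x $ i) - f m)) = 0"
proof -
  let ?v = "(\<Sum>i\<in>UNIV. p (x $ i) $ i * f (x $ i)) / (\<Sum>i\<in>UNIV. p (x $ i) $ i)"
  have W: "(\<Sum>i\<in>UNIV. p (x $ i) $ i) > 0"
    using x p by (intro sum_pos) (auto simp: cube_def)
  have "bajraktarevic_mean I f p x = m \<longleftrightarrow> inv_into I f ?v = m"
    unfolding bajraktarevic_mean_eq_inv_into(2)[OF x] ..
  also have "\<dots> \<longleftrightarrow> ?v = f m"
    using f_inv_into_f[OF bajraktarevic_mean_eq_inv_into(1)[OF x]]
      inv_into_f_f[OF strictly_monotone_on_imp_inj_on[OF f(1)] m] by auto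
  also have "\<dots> \<longleftrightarrow> (\<Sum>i\<in>UNIV. p (x $ i) $ i * f (x $ i)) = f m * (\<Sum>i\<in>UNIV. p (x $ i) $ i)"
    using W by (simp add: divide_eq_eq)
  also have "\<dots> \<longleftrightarrow> (\<Sum>i\<in>UNIV. p (x $ i) $ i * (f (x $ i) - f m)) = 0"
    by (simp add: right_diff_distrib sum_subtractf sum_distrib_left mult.commute)
  finally show ?thesis .
qed

end

section \<open>Equality of means, the Moebius form and the exchange relation\<close>

lemma open_cube: "open I \<Longrightarrow> open (cube I :: (real ^ 'n) set)"
  unfolding cube_def Collect_all_eq by (intro open_INT ballI) (auto intro: open_vimage_vec_nth simp: vimage_def[symmetric])

lemma globally_imp_locally_equal:
  fixes F G :: "real ^ 'n \<Rightarrow> real"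
  assumes "open I" "globally_equal I F G" shows "locally_equal I F G"
  using assms open_cube[OF assms(1)] unfolding locally_equal_def globally_equal_def
  by (intro exI[of _ "cube I"]) (auto simp: cube_def)

text \<open>Each summand \<open>q t $ k * (g t - g m)\<close> is
  \<open>p t $ k * (f t - f m)\<close> times a factor depending on \<open>m\<close> alone, so the
  sum vanishing for \<open>(f, p)\<close> also vanishes for \<open>(g, q)\<close>.\<close>

lemma moebius_imp_globally_equal:
  fixes p q :: "real \<Rightarrow> real ^ 'n"
  assumes I: "is_interval I"
    and f: "strictly_monotone_on I f" "continuous_on I f"
    and g: "strictly_monotone_on I g" "continuous_on I g"
    and p: "\<forall>x\<in>I. \<forall>k. p x $ k > 0" and q: "\<forall>x\<in>I. \<forall>k. q x $ k > 0"
    and rep: "\<forall>x\<in>I. c * f x + d > 0 \<and> g x = (a * f x + b) / (c * f x + d) \<and>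
      q x = (c * f x + d) *\<^sub>R p x"
  shows "globally_equal I (bajraktarevic_mean I f p) (bajraktarevic_mean I g q)"
  unfolding globally_equal_def
proof
  fix x :: "real ^ 'n" assume x: "x \<in> cube I"
  define m where "m = bajraktarevic_mean I f p x"
  have m: "m \<in> I" unfolding m_def by (rule bajraktarevic_mean_in[OF I f p x])
  have term_eq: "q t $ k * (g t - g m) = (a * d - b * c) / (c * f m + d) * (p t $ k * (f t - f m))"
    if t: "t \<in> I" for t k
  proof -
    have nz: "c * f t + d \<noteq> 0" "c * f m + d \<noteq> 0" using rep t m by auto
    have g_eq: "g t = (a * f t + b) / (c * f t + d)" "g m = (a * f m + b) / (c * f m + d)"
      using rep t m by auto
    have *: "(c * f t + d) * (g t - g m) = (a * d - b * c) / (c * f m + d) * (f t - f m)"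
      unfolding g_eq using nz by (simp add: divide_simps) (simp add: algebra_simps)
    have "q t $ k * (g t - g m) = p t $ k * ((c * f t + d) * (g t - g m))" using rep t by simp
    then show ?thesis unfolding * by simp
  qed
  have "(\<Sum>i\<in>UNIV. p (x $ i) $ i * (f (x $ i) - f m)) = 0"
    using bajraktarevic_mean_eq_iff[OF I f p x m] by (simp add: m_def)
  moreover have "(\<Sum>i\<in>UNIV. q (x $ i) $ i * (g (x $ i) - g m)) =
      (a * d - b * c) / (c * f m + d) * (\<Sum>i\<in>UNIV. p (x $ i) $ i * (f (x $ i) - f m))"
    using x unfolding sum_distrib_left by (intro sum.cong term_eq) (auto simp: cube_def)
  ultimately have "(\<Sum>i\<in>UNIV. q (x $ i) $ i * (g (x $ i) - g m)) = 0" by simp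
  then show "bajraktarevic_mean I f p x = bajraktarevic_mean I g q x"
    using bajraktarevic_mean_eq_iff[OF I g q x m] by (simp add: m_def)
qed

text \<open>Two coordinates vary and all others sit at the mean \<open>m\<close>, so that only two summands
  survive on either side.\<close>

lemma locally_equal_exchange:
  fixes p q :: "real \<Rightarrow> real ^ 'n"
  assumes I: "is_interval I" "open I"
    and f: "strictly_monotone_on I f" "continuous_on I f"
    and g: "strictly_monotone_on I g" "continuous_on I g"
    and p: "\<forall>x\<in>I. \<forall>k. p x $ k > 0" and q: "\<forall>x\<in>I. \<forall>k. q x $ k > 0"
    and eq: "locally_equal I (bajraktarevic_mean I f p) (bajraktarevic_mean I g q)"
    and e: "e \<in> I"
  obtains \<epsilon> where "\<epsilon> > 0" "\<And>x y m k l. \<lbrakk>k \<noteq> l; \<bar>x - e\<bar> < \<epsilon>; \<bar>y - e\<bar> < \<epsilon>; \<bar>m - e\<bar> < \<epsilon>;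
    p x $ k * (f x - f m) + p y $ l * (f y - f m) = 0\<rbrakk> \<Longrightarrow>
    q x $ k * (g x - g m) + q y $ l * (g y - g m) = 0"
proof -
  obtain U :: "(real ^ 'n) set" where U: "open U" "U \<subseteq> cube I" "\<And>t. t \<in> I \<Longrightarrow> (\<chi> i. t) \<in> U"
    "\<And>x. x \<in> U \<Longrightarrow> bajraktarevic_mean I f p x = bajraktarevic_mean I g q x"
    using eq unfolding locally_equal_def by blast
  obtain r where r: "r > 0" "ball (\<chi> i. e) r \<subseteq> U"
    using U(1,3) e open_contains_ball by metis
  \<comment> \<open>The Euclidean norm is at most the sum of the \<open>CARD('n)\<close> coordinate
    deviations, so this bound keeps the vector in the ball.\<close>
  define \<epsilon> where "\<epsilon> = r / real CARD('n)"
  have \<epsilon>: "\<epsilon> > 0" using r by (simp add: \<epsilon>_def)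
  have in_U: "u \<in> U" if "\<And>i. \<bar>u $ i - e\<bar> < \<epsilon>" for u :: "real ^ 'n"
  proof -
    have "norm (u - (\<chi> i. e)) \<le> (\<Sum>i\<in>UNIV. \<bar>(u - (\<chi> i. e)) $ i\<bar>)" by (rule norm_le_l1_cart)
    also have "\<dots> < (\<Sum>i\<in>(UNIV :: 'n set). \<epsilon>)" using that by (intro sum_strict_mono) auto
    also have "\<dots> = r" by (simp add: \<epsilon>_def)
    finally show ?thesis using r(2) by (auto simp: dist_norm norm_minus_commute)
  qed
  show thesis
  proof (rule that[OF \<epsilon>])
    fix x y m :: real and k l :: 'n
    assume kl: "k \<noteq> l" and near: "\<bar>x - e\<bar> < \<epsilon>" "\<bar>y - e\<bar> < \<epsilon>" "\<bar>m - e\<bar> < \<epsilon>"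
      and bal: "p x $ k * (f x - f m) + p y $ l * (f y - f m) = 0"
    define u :: "real ^ 'n" where "u = (\<chi> i. if i = k then x else if i = l then y else m)"
    have u: "u $ k = x" "u $ l = y" "\<And>i. i \<notin> {k, l} \<Longrightarrow> u $ i = m" using kl by (auto simp: u_def)
    have "u \<in> U" using near by (intro in_U) (auto simp: u_def)
    then have uI: "u \<in> cube I" using U by auto
    have "(\<chi> i. m) \<in> U" using near by (intro in_U) auto
    then have mI: "m \<in> I" using U by (auto simp: cube_def)
    have two_terms: "(\<Sum>i\<in>UNIV. w (u $ i) $ i * (\<phi> (u $ i) - \<phi> m)) =
        w x $ k * (\<phi> x - \<phi> m) + w y $ l * (\<phi> y - \<phi> m)" for w :: "real \<Rightarrow> real ^ 'n" and \<phi>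
    proof -
      have "(\<Sum>i\<in>UNIV. w (u $ i) $ i * (\<phi> (u $ i) - \<phi> m)) =
          (\<Sum>i\<in>{k, l}. w (u $ i) $ i * (\<phi> (u $ i) - \<phi> m))"
        by (rule sum.mono_neutral_right) (auto simp: u(3))
      then show ?thesis using kl u by simp
    qed
    have "bajraktarevic_mean I f p u = m"
      using bal bajraktarevic_mean_eq_iff[OF I(1) f p uI mI] by (simp only: two_terms)
    then have "bajraktarevic_mean I g q u = m" using U(4)[OF \<open>u \<in> U\<close>] by simp
    then show "q x $ k * (g x - g m) + q y $ l * (g y - g m) = 0"
      using bajraktarevic_mean_eq_iff[OF I(1) g q uI mI] by (simp only: two_terms)
  qed
qed

lemma pair_exchange_of_locally_equal:
  fixes p q :: "real \<Rightarrow> real ^ 'n"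
  assumes I: "is_interval I" "open I"
    and f: "strictly_monotone_on I f" "continuous_on I f"
    and g: "strictly_monotone_on I g" "continuous_on I g"
    and n: "CARD('n) \<ge> 2"
    and p: "\<forall>x\<in>I. \<forall>k. p x $ k > 0" and q: "\<forall>x\<in>I. \<forall>k. q x $ k > 0"
    and p_cont: "continuous_on I p"
    and eq: "locally_equal I (bajraktarevic_mean I f p) (bajraktarevic_mean I g q)"
  shows "pair_exchange (f ` I) (g \<circ> inv_into I f)
    (\<lambda>k y. p (inv_into I f y) $ k) (\<lambda>k y. q (inv_into I f y) $ k)"
proof
  let ?F = "inv_into I f"
  have inj: "inj_on f I" "inj_on g I" using f g by (auto intro: strictly_monotone_on_imp_inj_on)
  have F: "?F y \<in> I" "f (?F y) = y" if "y \<in> f ` I" for y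
    using that by (auto intro: inv_into_into f_inv_into_f)
  show open_J: "open (f ` I)" by (rule invariance_of_domain[OF f(2) I(2) inj(1)])
  show interval_J: "is_interval (f ` I)"
    using I f(2) by (simp add: is_interval_connected_1 connected_continuous_image)
  have F_cont: "continuous_on (f ` I) ?F"
    using inj(1) by (intro continuous_on_inverse_open[OF I(2) f(2)]) auto
  have F_img: "?F ` f ` I \<subseteq> I" using F by auto
  show "continuous_on (f ` I) (g \<circ> ?F)"
    using g(2) F_img by (intro continuous_on_compose F_cont) (rule continuous_on_subset)
  show "inj_on (g \<circ> ?F) (f ` I)"
    using inj(2) F_img inj_on_inv_into[of "f ` I" f I] by (intro comp_inj_on) (auto intro: inj_on_subset)
  show "continuous_on (f ` I) (\<lambda>y. p (?F y) $ k)" for k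
    by (intro continuous_intros continuous_on_compose2[OF p_cont F_cont F_img])
  show "p (?F x) $ k > 0" "q (?F x) $ k > 0" if "x \<in> f ` I" for x k
    using p q F(1)[OF that] by auto
  show "\<exists>l. l \<noteq> k" for k :: 'n
  proof (rule ccontr)
    assume "\<nexists>l. l \<noteq> k"
    then have "(UNIV :: 'n set) = {k}" by auto
    then show False using n by (metis card_1_singleton_iff One_nat_def Suc_1 not_less_eq_eq le_refl)
  qed
  fix e assume e: "e \<in> f ` I"
  obtain \<epsilon> where \<epsilon>: "\<epsilon> > 0" "\<And>x y m k l. \<lbrakk>k \<noteq> l; \<bar>x - ?F e\<bar> < \<epsilon>; \<bar>y - ?F e\<bar> < \<epsilon>; \<bar>m - ?F e\<bar> < \<epsilon>;
    p x $ k * (f x - f m) + p y $ l * (f y - f m) = 0\<rbrakk> \<Longrightarrow>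
    q x $ k * (g x - g m) + q y $ l * (g y - g m) = 0"
    using locally_equal_exchange[OF I f g p q eq F(1)[OF e]] by metis
  obtain \<delta>1 where \<delta>1: "\<delta>1 > 0" "\<And>y. y \<in> f ` I \<Longrightarrow> \<bar>y - e\<bar> < \<delta>1 \<Longrightarrow> \<bar>?F y - ?F e\<bar> < \<epsilon>"
    using F_cont e \<epsilon>(1) unfolding continuous_on_iff dist_real_def by metis
  obtain \<delta>2 where \<delta>2: "\<delta>2 > 0" "\<And>y. \<bar>y - e\<bar> < \<delta>2 \<Longrightarrow> y \<in> f ` I"
    using open_J e unfolding open_dist dist_real_def by metis
  show "\<exists>\<delta>>0. \<forall>x y m k l. k \<noteq> l \<longrightarrow> \<bar>x - e\<bar> < \<delta> \<longrightarrow> \<bar>y - e\<bar> < \<delta> \<longrightarrow>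
    p (?F x) $ k * (x - m) + p (?F y) $ l * (y - m) = 0 \<longrightarrow>
    q (?F x) $ k * ((g \<circ> ?F) x - (g \<circ> ?F) m) + q (?F y) $ l * ((g \<circ> ?F) y - (g \<circ> ?F) m) = 0"
  proof (intro exI[of _ "min \<delta>1 \<delta>2"] conjI allI impI)
    show "min \<delta>1 \<delta>2 > 0" using \<delta>1 \<delta>2 by simp
    fix x y m k l
    assume kl: "k \<noteq> l" and x: "\<bar>x - e\<bar> < min \<delta>1 \<delta>2" and y: "\<bar>y - e\<bar> < min \<delta>1 \<delta>2"
      and bal: "p (?F x) $ k * (x - m) + p (?F y) $ l * (y - m) = 0"
    have xyJ: "x \<in> f ` I" "y \<in> f ` I" using x y \<delta>2 by auto
    have pos: "p (?F x) $ k > 0" "p (?F y) $ l > 0" using p F xyJ by auto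
    \<comment> \<open>Outside this range both summands of the balance would have the same strict
      sign. Nearness of \<open>m\<close> to \<open>e\<close> follows.\<close>
    have "min x y \<le> m \<and> m \<le> max x y"
    proof (rule ccontr)
      assume "\<not> (min x y \<le> m \<and> m \<le> max x y)"
      then consider "x - m > 0" "y - m > 0" | "x - m < 0" "y - m < 0" by linarith
      then show False
      proof cases
        case 1
        then show False using bal pos by (smt (verit) mult_pos_pos)
      next
        case 2
        then show False using bal pos by (smt (verit) mult_pos_neg)
      qed
    qed
    then have m: "\<bar>m - e\<bar> < min \<delta>1 \<delta>2" using x y by linarith
    have mJ: "m \<in> f ` I" using m \<delta>2 by auto
    show "q (?F x) $ k * ((g \<circ> ?F) x - (g \<circ> ?F) m) + q (?F y) $ l * ((g \<circ> ?F) y - (g \<circ> ?F) m) = 0"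
      unfolding o_def
    proof (rule \<epsilon>(2)[OF kl])
      show "p (?F x) $ k * (f (?F x) - f (?F m)) + p (?F y) $ l * (f (?F y) - f (?F m)) = 0"
        using bal F(2) xyJ mJ by simp
    qed (use x y m xyJ mJ in \<open>auto intro!: \<delta>1(2)\<close>)
  qed
qed

theorem theorem18:
  fixes I :: "real set" and f g :: "real \<Rightarrow> real" and p q :: "real \<Rightarrow> real ^ 'n"
  assumes I: "I \<noteq> {}" "open I" "is_interval I"
    and f: "strictly_monotone_on I f" "continuous_on I f"
    and g: "strictly_monotone_on I g" "continuous_on I g"
    and n: "CARD('n) \<ge> 2"
    and p_pos: "\<forall>x\<in>I. \<forall>k. p x $ k > 0"
    and q_pos: "\<forall>x\<in>I. \<forall>k. q x $ k > 0"
    and p_cont: "continuous_on I p"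
    and regular: "\<exists>i j I0. i \<noteq> j \<and> I0 \<noteq> {} \<and> open I0 \<and> is_interval I0 \<and> I0 \<subseteq> I \<and>
      (\<forall>x\<in>I0. p x $ i \<noteq> p x $ j) \<and>
      ((\<lambda>x. p x $ i) \<circ> inv_into I f) C1_differentiable_on (f ` I0) \<and>
      ((\<lambda>x. p x $ j) \<circ> inv_into I f) C1_differentiable_on (f ` I0) \<and>
      (g \<circ> inv_into I f) C1_differentiable_on (f ` I0) \<and>
      (\<forall>y\<in>f ` I0. deriv (g \<circ> inv_into I f) y \<noteq> 0)"
  shows "(globally_equal I (bajraktarevic_mean I f p) (bajraktarevic_mean I g q) \<longleftrightarrow>
            locally_equal I (bajraktarevic_mean I f p) (bajraktarevic_mean I g q)) \<and>
         (locally_equal I (bajraktarevic_mean I f p) (bajraktarevic_mean I g q) \<longleftrightarrow>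
            (\<exists>a b c d. a * d \<noteq> b * c \<and>
              (\<forall>x\<in>I. c * f x + d > 0 \<and> g x = (a * f x + b) / (c * f x + d) \<and>
                      q x = (c * f x + d) *\<^sub>R p x)))"
proof -
  let ?F = "inv_into I f"
  let ?global = "globally_equal I (bajraktarevic_mean I f p) (bajraktarevic_mean I g q)"
  let ?local = "locally_equal I (bajraktarevic_mean I f p) (bajraktarevic_mean I g q)"
  let ?rep = "\<exists>a b c d. a * d \<noteq> b * c \<and>
    (\<forall>x\<in>I. c * f x + d > 0 \<and> g x = (a * f x + b) / (c * f x + d) \<and> q x = (c * f x + d) *\<^sub>R p x)"
  \<comment> \<open>The implications are closed in a cycle: representation, global equality, local
    equality, representation.\<close>
  have ?global if rep: ?rep
  proof -
    obtain a b c d where "\<forall>x\<in>I. c * f x + d > 0 \<and> g x = (a * f x + b) / (c * f x + d) \<and>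
      q x = (c * f x + d) *\<^sub>R p x" using rep by blast
    then show ?thesis by (rule moebius_imp_globally_equal[OF I(3) f g p_pos q_pos])
  qed
  moreover have "?global \<Longrightarrow> ?local" by (rule globally_imp_locally_equal[OF I(2)])
  moreover have ?rep if ?local
  proof -
    interpret pair_exchange "f ` I" "g \<circ> ?F" "\<lambda>k y. p (?F y) $ k" "\<lambda>k y. q (?F y) $ k"
      by (rule pair_exchange_of_locally_equal[OF I(3,2) f g n p_pos q_pos p_cont that])
    have inj: "inj_on f I" by (rule strictly_monotone_on_imp_inj_on[OF f(1)])
    obtain i j I0 where I0: "I0 \<noteq> {}" "open I0" "I0 \<subseteq> I" and ne: "\<And>x. x \<in> I0 \<Longrightarrow> p x $ i \<noteq> p x $ j"
      and C1: "(g \<circ> ?F) C1_differentiable_on (f ` I0)"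
      and nz: "\<And>y. y \<in> f ` I0 \<Longrightarrow> deriv (g \<circ> ?F) y \<noteq> 0"
      using regular by metis
    obtain x0 where x0: "x0 \<in> I0" using I0(1) by auto
    have "open (f ` I0)"
      using f(2) I0 inj by (intro invariance_of_domain) (auto intro: continuous_on_subset inj_on_subset)
    moreover have "f ` I0 \<subseteq> f ` I" using I0 by auto
    moreover have "\<exists>D. D \<noteq> 0 \<and> ((g \<circ> ?F) has_real_derivative D) (at z)" if "z \<in> f ` I0" for z
    proof -
      \<comment> \<open>An actual derivative is produced first; only then does \<open>deriv\<close>
        denote it and the nonvanishing condition apply to it.\<close>
      obtain D where "\<forall>y\<in>f ` I0. ((g \<circ> ?F) has_vector_derivative D y) (at y)"
        using C1 unfolding C1_differentiable_on_def by blast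
      then have "((g \<circ> ?F) has_real_derivative D z) (at z)"
        unfolding has_real_derivative_iff_has_vector_derivative using that by (rule bspec)
      then show ?thesis using nz[OF that] DERIV_imp_deriv by metis
    qed
    moreover have "p (?F (f x0)) $ i \<noteq> p (?F (f x0)) $ j"
      using ne[OF x0] inj I0 x0 by (metis inv_into_f_f subsetD)
    ultimately obtain a b c d where abcd: "a * d \<noteq> b * c"
      "\<And>y. y \<in> f ` I \<Longrightarrow> c * y + d > 0 \<and> (g \<circ> ?F) y = (a * y + b) / (c * y + d) \<and>
        (\<forall>k. q (?F y) $ k = (c * y + d) * p (?F y) $ k)"
      using moebius_representation[of "f x0" "f ` I0" i j] x0 by (metis imageI)
    have "c * f x + d > 0 \<and> g x = (a * f x + b) / (c * f x + d) \<and> q x = (c * f x + d) *\<^sub>R p x"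
      if "x \<in> I" for x
      using abcd(2)[of "f x"] that inj by (simp add: vec_eq_iff)
    then show ?rep using abcd(1) by blast
  qed
  ultimately show ?thesis by blast
qed

end
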